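(* Let $\alpha:I\to E^3$ be a Frenet curve in $E^3$ and let $\beta$ be a Bertrand-direction curve of $\alpha$. The following statements are equivalent: (i) $\alpha$ is a helix in $E^3$. (ii) $\alpha$ is a Bertrand-donor curve of a helix. (iii) A Bertrand-direction curve of $\alpha$ is a helix.
   Context: $I\subset\mathbb{R}$ is an open interval and curves are smooth. A unit speed curve $\alpha:I\to E^3$ is a Frenet curve if its curvature $\kappa=\|\alpha''\|$ is nowhere zero; then $T=\alpha'$, $N=\alpha''/\kappa$, $B=T\times N$, and $T'=\kappa N$, $N'=-\kappa T+\tau B$, $B'=-\tau N$, where $\tau$ is the torsion. For a unit vector field $X(s)=a(s)T(s)+b(s)N(s)+c(s)B(s)$ with $a,b,c$ smooth and $a^2+b^2+c^2=1$, an $X$-direction curve of $\alpha$ is a curve $\beta:I\to E^3$ with $\beta'(s)=X(s)$; the parameter $s$ is then also arc length for $\beta$, whose Frenet apparatus is $\{\overline T,\overline N,\overline B\},\overline\kappa,\overline\tau$. An $X$-direction curve $\beta$ of $\alpha$ (for some such $X$) is called a Bertrand-direction curve of $\alpha$ if $\beta$ is a Bertrand curve of $\alpha$ (and $\alpha$ a Bertrand partner curve of $\beta$), in the sense that $\beta$ is a Frenet curve with $\overline N=N$ at each common parameter value $s$; then $\alpha$ is called a Bertrand-donor curve of $\beta$. A Frenet curve is a (general) helix if the ratio of its torsion to its curvature is constant. *)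

theory Defs
  imports "HOL-Analysis.Analysis"
begin

text \<open>
  Euclidean 3-space is \<^typ>\<open>real^3\<close>.  A curve \<open>I \<rightarrow> E\<^sup>3\<close> is a total function
  \<open>real \<Rightarrow> real^3\<close> of which only the values on the open set \<open>I\<close> matter: every
  derivative below is taken at a point of \<open>I\<close> and hence depends only on the
  restriction to \<open>I\<close>.
\<close>

definition vderiv :: "(real \<Rightarrow> 'a::real_normed_vector) \<Rightarrow> real \<Rightarrow> 'a" where
  "vderiv f s = vector_derivative f (at s)"

definition smooth_on :: "real set \<Rightarrow> (real \<Rightarrow> 'a::real_normed_vector) \<Rightarrow> bool" where
  "smooth_on I f \<longleftrightarrow> (\<forall>n. \<forall>s\<in>I. (vderiv ^^ n) f differentiable (at s))"

definition tangent :: "(real \<Rightarrow> real^3) \<Rightarrow> real \<Rightarrow> real^3" where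
  "tangent \<alpha> s = vderiv \<alpha> s"

definition curvature :: "(real \<Rightarrow> real^3) \<Rightarrow> real \<Rightarrow> real" where
  "curvature \<alpha> s = norm (vderiv (vderiv \<alpha>) s)"

definition normal :: "(real \<Rightarrow> real^3) \<Rightarrow> real \<Rightarrow> real^3" where
  "normal \<alpha> s = vderiv (vderiv \<alpha>) s /\<^sub>R curvature \<alpha> s"

definition binormal :: "(real \<Rightarrow> real^3) \<Rightarrow> real \<Rightarrow> real^3" where
  "binormal \<alpha> s = cross3 (tangent \<alpha> s) (normal \<alpha> s)"

text \<open>
  The sign of the torsion is the one for which the Frenet equation
  \<open>B' = - \<tau> N\<close> holds; \<open>N\<close> being a unit vector, this says \<open>\<tau> = - B' \<bullet> N\<close>.
\<close>

definition torsion :: "(real \<Rightarrow> real^3) \<Rightarrow> real \<Rightarrow> real" where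
  "torsion \<alpha> s = - (vderiv (binormal \<alpha>) s \<bullet> normal \<alpha> s)"

definition frenet_curve :: "real set \<Rightarrow> (real \<Rightarrow> real^3) \<Rightarrow> bool" where
  "frenet_curve I \<alpha> \<longleftrightarrow>
     smooth_on I \<alpha> \<and> (\<forall>s\<in>I. norm (vderiv \<alpha> s) = 1) \<and> (\<forall>s\<in>I. curvature \<alpha> s \<noteq> 0)"

definition helix :: "real set \<Rightarrow> (real \<Rightarrow> real^3) \<Rightarrow> bool" where
  "helix I \<alpha> \<longleftrightarrow>
     frenet_curve I \<alpha> \<and> (\<exists>m. \<forall>s\<in>I. torsion \<alpha> s / curvature \<alpha> s = m)"

definition unit_frame_field :: "real set \<Rightarrow> (real \<Rightarrow> real^3) \<Rightarrow> (real \<Rightarrow> real^3) \<Rightarrow> bool" where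
  "unit_frame_field I \<alpha> X \<longleftrightarrow>
     (\<exists>a b c :: real \<Rightarrow> real. smooth_on I a \<and> smooth_on I b \<and> smooth_on I c \<and>
        (\<forall>s\<in>I. (a s)\<^sup>2 + (b s)\<^sup>2 + (c s)\<^sup>2 = 1 \<and>
           X s = a s *\<^sub>R tangent \<alpha> s + b s *\<^sub>R normal \<alpha> s + c s *\<^sub>R binormal \<alpha> s))"

text \<open>\<open>direction_curve I \<alpha> X \<beta>\<close>: \<open>\<beta>\<close> is an \<open>X\<close>-direction curve of \<open>\<alpha>\<close>.\<close>

definition direction_curve ::
  "real set \<Rightarrow> (real \<Rightarrow> real^3) \<Rightarrow> (real \<Rightarrow> real^3) \<Rightarrow> (real \<Rightarrow> real^3) \<Rightarrow> bool" where
  "direction_curve I \<alpha> X \<beta> \<longleftrightarrow>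
     unit_frame_field I \<alpha> X \<and> (\<forall>s\<in>I. (\<beta> has_vector_derivative X s) (at s))"

text \<open>
  \<open>bertrand_curve I \<alpha> \<beta>\<close>: \<open>\<beta>\<close> is a Bertrand curve of \<open>\<alpha>\<close>.  The principal normals
  coincide as vectors, not merely up to sign or as lines.
\<close>

definition bertrand_curve :: "real set \<Rightarrow> (real \<Rightarrow> real^3) \<Rightarrow> (real \<Rightarrow> real^3) \<Rightarrow> bool" where
  "bertrand_curve I \<alpha> \<beta> \<longleftrightarrow>
     frenet_curve I \<alpha> \<and> frenet_curve I \<beta> \<and> (\<forall>s\<in>I. normal \<beta> s = normal \<alpha> s)"

text \<open>\<open>bertrand_direction_curve I \<alpha> \<beta>\<close>: \<open>\<beta>\<close> is a Bertrand-direction curve of \<open>\<alpha>\<close>.\<close>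

definition bertrand_direction_curve ::
  "real set \<Rightarrow> (real \<Rightarrow> real^3) \<Rightarrow> (real \<Rightarrow> real^3) \<Rightarrow> bool" where
  "bertrand_direction_curve I \<alpha> \<beta> \<longleftrightarrow>
     (\<exists>X. direction_curve I \<alpha> X \<beta>) \<and> bertrand_curve I \<alpha> \<beta>"

text \<open>\<open>bertrand_donor_curve I \<beta> \<alpha>\<close>: \<open>\<alpha>\<close> is a Bertrand-donor curve of \<open>\<beta>\<close>.\<close>

definition bertrand_donor_curve ::
  "real set \<Rightarrow> (real \<Rightarrow> real^3) \<Rightarrow> (real \<Rightarrow> real^3) \<Rightarrow> bool" where
  "bertrand_donor_curve I \<beta> \<alpha> \<longleftrightarrow> bertrand_direction_curve I \<alpha> \<beta>"

end

theory Submission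
  imports Defs
begin

text \<open>
  A general helix is a curve that makes a constant angle with a fixed direction.  In terms of the
  principal normal alone: \<open>\<alpha>\<close> is a helix iff some fixed vector \<open>w \<noteq> 0\<close> is orthogonal to every
  \<open>N(s)\<close> (\<open>helix_iff_axis\<close>).  Indeed, if \<open>\<tau> = m \<kappa>\<close>, then \<open>m T + B\<close> has derivative
  \<open>(m \<kappa> - \<tau>) N = 0\<close> and is such an axis.  Conversely, let \<open>w \<bullet> N = 0\<close>.  Then \<open>w \<bullet> T\<close> and
  \<open>w \<bullet> B\<close> are constant, since \<open>T'\<close> and \<open>B'\<close> are multiples of \<open>N\<close>, and differentiating
  \<open>w \<bullet> N = 0\<close> gives \<open>\<tau> (w \<bullet> B) = \<kappa> (w \<bullet> T)\<close>.  Here \<open>w \<bullet> B \<noteq> 0\<close>, for otherwise \<open>w\<close> would be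
  orthogonal to the whole frame.

  A curve and a Bertrand-direction curve of it have the same principal normal, so an axis of one is
  an axis of the other, and one is a helix iff the other is.  Both equivalences are instances of
  this: the helix required by the existential one may be taken to be \<open>\<beta>\<close>.
\<close>

section \<open>The Frenet equations\<close>

text \<open>
  The product \<open>x \<times> (t \<times> n)\<close> expands into multiples of \<open>x \<bullet> t\<close> and \<open>x \<bullet> n\<close>, so \<open>x\<close> is both parallel
  and orthogonal to \<open>t \<times> n\<close>.
\<close>

lemma orthogonal_to_cross3_frame_imp_zero:
  fixes t n x :: "real^3"
  assumes "cross3 t n \<noteq> 0" and "x \<bullet> t = 0" "x \<bullet> n = 0" "x \<bullet> cross3 t n = 0"
  shows "x = 0"
proof -
  have "cross3 x (cross3 t n) = 0"
    using assms by (simp add: Lagrange)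
  then show ?thesis
    using assms norm_and_cross_eq_0[of x "cross3 t n"] by auto
qed

lemma vderiv_works:
  "f differentiable (at s) \<Longrightarrow> (f has_vector_derivative vderiv f s) (at s)"
  unfolding vderiv_def using vector_derivative_works by blast

lemma inner_has_real_derivative:
  assumes "(f has_vector_derivative f') (at s)" "(g has_vector_derivative g') (at s)"
  shows "((\<lambda>s. f s \<bullet> g s) has_real_derivative f s \<bullet> g' + f' \<bullet> g s) (at s)"
  using bounded_bilinear.has_vector_derivative[OF bounded_bilinear_inner assms]
  by (simp add: has_real_derivative_iff_has_vector_derivative)

lemma inner_const_derivative_zero:
  assumes I: "open I" "s \<in> I" and const: "\<And>s. s \<in> I \<Longrightarrow> f s \<bullet> g s = c"
    and "(f has_vector_derivative f') (at s)" "(g has_vector_derivative g') (at s)"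
  shows "f s \<bullet> g' + f' \<bullet> g s = 0"
proof -
  have "((\<lambda>s. f s \<bullet> g s) has_real_derivative 0) (at s)"
    by (rule has_field_derivative_transform_within_open[OF DERIV_const[of c] I])
       (simp add: const)
  then show ?thesis
    using inner_has_real_derivative[OF assms(4,5)] DERIV_unique by blast
qed

lemma cross3_has_vector_derivative:
  assumes "(f has_vector_derivative f') (at s)" "(g has_vector_derivative g') (at s)"
  shows "((\<lambda>s. cross3 (f s) (g s)) has_vector_derivative cross3 (f s) g' + cross3 f' (g s)) (at s)"
  using bilinear_cross bounded_bilinear.has_vector_derivative[OF _ assms]
  by (simp add: bilinear_conv_bounded_bilinear)

context
  fixes I :: "real set" and \<alpha> :: "real \<Rightarrow> real^3"
  assumes I: "open I" and frenet: "frenet_curve I \<alpha>"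
begin

lemma differentiable_vderivs:
  assumes "s \<in> I"
  shows "vderiv \<alpha> differentiable (at s)" "vderiv (vderiv \<alpha>) differentiable (at s)"
proof -
  have *: "(vderiv ^^ n) \<alpha> differentiable (at s)" for n
    using frenet assms by (auto simp: frenet_curve_def smooth_on_def)
  show "vderiv \<alpha> differentiable (at s)" "vderiv (vderiv \<alpha>) differentiable (at s)"
    using *[of 1] *[of 2] by (simp_all add: eval_nat_numeral)
qed

lemma curvature_pos: "s \<in> I \<Longrightarrow> curvature \<alpha> s > 0"
  using frenet by (auto simp: frenet_curve_def curvature_def)

lemma tangent_unit: "s \<in> I \<Longrightarrow> tangent \<alpha> s \<bullet> tangent \<alpha> s = 1"
  using frenet by (auto simp: frenet_curve_def tangent_def norm_eq_1)

lemma normal_unit: "s \<in> I \<Longrightarrow> normal \<alpha> s \<bullet> normal \<alpha> s = 1"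
  using curvature_pos[of s] unfolding norm_eq_1[symmetric] by (simp add: normal_def curvature_def)

lemma tangent_deriv:
  assumes "s \<in> I"
  shows "(tangent \<alpha> has_vector_derivative curvature \<alpha> s *\<^sub>R normal \<alpha> s) (at s)"
proof -
  have "tangent \<alpha> = vderiv \<alpha>"
    by (rule ext) (simp add: tangent_def)
  then show ?thesis
    using vderiv_works[OF differentiable_vderivs(1)[OF assms]] curvature_pos[OF assms]
    by (simp add: normal_def)
qed

lemma tangent_normal_orthogonal:
  assumes "s \<in> I"
  shows "tangent \<alpha> s \<bullet> normal \<alpha> s = 0"
  using inner_const_derivative_zero[OF I assms tangent_unit
      tangent_deriv[OF assms] tangent_deriv[OF assms]]
    curvature_pos[OF assms] by (simp add: inner_commute)

lemma normal_differentiable: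
  assumes "s \<in> I"
  shows "normal \<alpha> differentiable (at s)"
proof -
  have "vderiv (vderiv \<alpha>) s \<noteq> 0"
    using curvature_pos[OF assms] by (auto simp: curvature_def)
  moreover have "normal \<alpha> = (\<lambda>s. vderiv (vderiv \<alpha>) s /\<^sub>R norm (vderiv (vderiv \<alpha>) s))"
    by (rule ext) (simp add: normal_def curvature_def)
  ultimately show ?thesis
    using differentiable_vderivs(2)[OF assms]
    by (auto intro!: differentiable_scaleR differentiable_inverse
        differentiable_compose[of norm "vderiv (vderiv \<alpha>)"] differentiable_norm_at)
qed

lemma binormal_unit: "s \<in> I \<Longrightarrow> binormal \<alpha> s \<bullet> binormal \<alpha> s = 1"
  using norm_cross_dot[of "tangent \<alpha> s" "normal \<alpha> s"] tangent_unit normal_unit tangent_normal_orthogonal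
  by (simp add: binormal_def power_mult_distrib power2_norm_eq_inner)

lemma orthogonal_to_frenet_frame_imp_zero:
  assumes "s \<in> I" and "x \<bullet> tangent \<alpha> s = 0" "x \<bullet> normal \<alpha> s = 0" "x \<bullet> binormal \<alpha> s = 0"
  shows "x = 0"
  using assms binormal_unit[of s]
  by (intro orthogonal_to_cross3_frame_imp_zero[of "tangent \<alpha> s" "normal \<alpha> s"])
     (auto simp: binormal_def)

text \<open>
  \<open>B'\<close> is orthogonal to \<open>B\<close>, which is a unit vector, and to \<open>T\<close>, since \<open>B \<bullet> T = 0\<close> and
  \<open>B \<bullet> T' = \<kappa> (B \<bullet> N) = 0\<close>.  What remains is its component along \<open>N\<close>.
\<close>

lemma binormal_deriv:
  assumes s: "s \<in> I"
  shows "(binormal \<alpha> has_vector_derivative - torsion \<alpha> s *\<^sub>R normal \<alpha> s) (at s)"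
proof -
  let ?B' = "vderiv (binormal \<alpha>) s"
  have "(binormal \<alpha> has_vector_derivative
      cross3 (tangent \<alpha> s) (vderiv (normal \<alpha>) s)
      + cross3 (curvature \<alpha> s *\<^sub>R normal \<alpha> s) (normal \<alpha> s)) (at s)"
    using cross3_has_vector_derivative[OF tangent_deriv[OF s] vderiv_works[OF normal_differentiable[OF s]]]
    unfolding binormal_def[abs_def] .
  then have B': "(binormal \<alpha> has_vector_derivative ?B') (at s)"
    by (intro vderiv_works) (rule differentiableI_vector)
  have "?B' \<bullet> binormal \<alpha> s = 0"
    using inner_const_derivative_zero[OF I s binormal_unit B' B'] by (simp add: inner_commute)
  moreover have "?B' \<bullet> tangent \<alpha> s = 0"
    using inner_const_derivative_zero[OF I s _ B' tangent_deriv[OF s], of 0]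
    by (simp add: binormal_def dot_cross_self)
  ultimately have "?B' - (- torsion \<alpha> s *\<^sub>R normal \<alpha> s) = 0"
    using tangent_normal_orthogonal[OF s] normal_unit[OF s]
    by (intro orthogonal_to_frenet_frame_imp_zero[OF s])
       (simp_all add: torsion_def inner_diff_right binormal_def dot_cross_self inner_commute)
  then have "?B' = - torsion \<alpha> s *\<^sub>R normal \<alpha> s"
    by (rule right_minus_eq[THEN iffD1])
  with B' show ?thesis by simp
qed

lemma normal_eq_cross3:
  "s \<in> I \<Longrightarrow> normal \<alpha> s = cross3 (binormal \<alpha> s) (tangent \<alpha> s)"
  using Lagrange[of "tangent \<alpha> s" "tangent \<alpha> s" "normal \<alpha> s"] tangent_unit tangent_normal_orthogonal
    cross_skew[of "binormal \<alpha> s" "tangent \<alpha> s"]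
  by (simp add: binormal_def)

text \<open>Differentiate \<open>N = B \<times> T\<close>; the derivatives of both factors are already known.\<close>

lemma normal_deriv:
  assumes s: "s \<in> I"
  shows "(normal \<alpha> has_vector_derivative
           torsion \<alpha> s *\<^sub>R binormal \<alpha> s - curvature \<alpha> s *\<^sub>R tangent \<alpha> s) (at s)"
proof -
  have BN: "cross3 (binormal \<alpha> s) (normal \<alpha> s) = - tangent \<alpha> s"
    using Lagrange[of "normal \<alpha> s" "tangent \<alpha> s" "normal \<alpha> s"] normal_unit[OF s]
      tangent_normal_orthogonal[OF s] cross_skew[of "binormal \<alpha> s" "normal \<alpha> s"]
    by (simp add: binormal_def inner_commute)
  have NT: "cross3 (normal \<alpha> s) (tangent \<alpha> s) = - binormal \<alpha> s"
    unfolding binormal_def by (rule cross_skew)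
  have "((\<lambda>s. cross3 (binormal \<alpha> s) (tangent \<alpha> s)) has_vector_derivative
      torsion \<alpha> s *\<^sub>R binormal \<alpha> s - curvature \<alpha> s *\<^sub>R tangent \<alpha> s) (at s)"
    using cross3_has_vector_derivative[OF binormal_deriv[OF s] tangent_deriv[OF s]]
    by (simp add: cross_mult_left cross_mult_right BN NT cross_minus_left)
  then show ?thesis
    by (rule has_vector_derivative_transform_within_open[OF _ I s]) (simp add: normal_eq_cross3)
qed

section \<open>Helices and their axes\<close>

lemma inner_axis_constant:
  assumes "connected I" and "\<And>s. s \<in> I \<Longrightarrow> w \<bullet> normal \<alpha> s = 0"
  obtains a c where "\<And>s. s \<in> I \<Longrightarrow> w \<bullet> tangent \<alpha> s = a" "\<And>s. s \<in> I \<Longrightarrow> w \<bullet> binormal \<alpha> s = c"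
proof -
  have const: "\<exists>k. \<forall>s\<in>I. w \<bullet> f s = k"
    if f: "\<And>s. s \<in> I \<Longrightarrow> (f has_vector_derivative g s *\<^sub>R normal \<alpha> s) (at s)" for f g
  proof -
    have "((\<lambda>s. w \<bullet> f s) has_real_derivative 0) (at s)" if "s \<in> I" for s
      using inner_has_real_derivative[OF has_vector_derivative_const f[OF that], of w] assms(2)[OF that]
      by simp
    then have "(\<lambda>s. w \<bullet> f s) constant_on I"
      using \<open>connected I\<close> I by (rule has_field_derivative_0_imp_constant_on)
    then show ?thesis
      by (simp add: constant_on_def)
  qed
  then show ?thesis
    using const[OF tangent_deriv] const[OF binormal_deriv] that by blast
qed

text \<open>
  The vector \<open>w\<close> spans the axis of the helix.  The criterion mentions only the principal normal,
  which is the datum that Bertrand partners share.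
\<close>

lemma helix_iff_axis:
  assumes "is_interval I" and "I \<noteq> {}"
  shows "helix I \<alpha> \<longleftrightarrow> (\<exists>w. w \<noteq> 0 \<and> (\<forall>s\<in>I. w \<bullet> normal \<alpha> s = 0))"
proof
  assume "helix I \<alpha>"
  then obtain m where m: "\<And>s. s \<in> I \<Longrightarrow> torsion \<alpha> s / curvature \<alpha> s = m"
    by (auto simp: helix_def)
  let ?W = "\<lambda>s. m *\<^sub>R tangent \<alpha> s + binormal \<alpha> s"
  have "(?W has_vector_derivative 0) (at s within I)" if "s \<in> I" for s
  proof -
    have "torsion \<alpha> s = m * curvature \<alpha> s"
      using m[OF that] curvature_pos[OF that] by (simp add: field_simps)
    then show ?thesis
      using has_vector_derivative_add[OF has_vector_derivative_scaleR[OF DERIV_const tangent_deriv[OF that], of m]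
        binormal_deriv[OF that]]
      by (simp add: has_vector_derivative_at_within)
  qed
  then obtain w where w: "\<And>s. s \<in> I \<Longrightarrow> ?W s = w"
    using has_vector_derivative_zero_constant[of I ?W] assms is_interval_convex by blast
  have "w \<bullet> normal \<alpha> s = 0" "w \<bullet> binormal \<alpha> s = 1" if "s \<in> I" for s
    using tangent_normal_orthogonal[OF that] binormal_unit[OF that]
    by (simp_all add: w[OF that, symmetric] inner_add_left binormal_def dot_cross_self)
  moreover from this(2) have "w \<noteq> 0"
    using \<open>I \<noteq> {}\<close> by auto
  ultimately show "\<exists>w. w \<noteq> 0 \<and> (\<forall>s\<in>I. w \<bullet> normal \<alpha> s = 0)"
    by blast
next
  assume "\<exists>w. w \<noteq> 0 \<and> (\<forall>s\<in>I. w \<bullet> normal \<alpha> s = 0)"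
  then obtain w where "w \<noteq> 0" and wN: "\<And>s. s \<in> I \<Longrightarrow> w \<bullet> normal \<alpha> s = 0" by blast
  obtain a c where a: "\<And>s. s \<in> I \<Longrightarrow> w \<bullet> tangent \<alpha> s = a" and c: "\<And>s. s \<in> I \<Longrightarrow> w \<bullet> binormal \<alpha> s = c"
    using inner_axis_constant[OF is_interval_connected[OF assms(1)] wN] by blast
  have eq: "torsion \<alpha> s * c = curvature \<alpha> s * a" if "s \<in> I" for s
    using inner_const_derivative_zero[OF I that wN has_vector_derivative_const normal_deriv[OF that]]
    by (simp add: inner_diff_right a[OF that] c[OF that])
  have "torsion \<alpha> s / curvature \<alpha> s = a / c" if s: "s \<in> I" for s
  proof -
    have "c \<noteq> 0"
    proof
      assume "c = 0"
      with eq[OF s] curvature_pos[OF s] have "a = 0" by simp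
      with \<open>c = 0\<close> \<open>w \<noteq> 0\<close> show False
        using orthogonal_to_frenet_frame_imp_zero[OF s, of w] a c wN s by simp
    qed
    then show ?thesis
      using eq[OF s] curvature_pos[OF s] by (simp add: field_simps)
  qed
  with frenet show "helix I \<alpha>"
    by (auto simp: helix_def)
qed

end

section \<open>Bertrand-direction curves\<close>

lemma helix_iff_bertrand_curve_helix:
  assumes "open I" "is_interval I" "I \<noteq> {}" and "bertrand_curve I \<alpha> \<beta>"
  shows "helix I \<alpha> \<longleftrightarrow> helix I \<beta>"
  using assms helix_iff_axis[of I \<alpha>] helix_iff_axis[of I \<beta>] by (simp add: bertrand_curve_def)

theorem theorem5p7:
  fixes I :: "real set" and \<alpha> \<beta> :: "real \<Rightarrow> real^3"
  assumes "open I" and "is_interval I" and "I \<noteq> {}"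
    and "frenet_curve I \<alpha>"
    and "bertrand_direction_curve I \<alpha> \<beta>"
  shows "(helix I \<alpha> \<longleftrightarrow> (\<exists>\<gamma>. helix I \<gamma> \<and> bertrand_donor_curve I \<gamma> \<alpha>)) \<and>
         (helix I \<alpha> \<longleftrightarrow> helix I \<beta>)"
proof -
  have "helix I \<alpha> \<longleftrightarrow> helix I \<gamma>" if "bertrand_direction_curve I \<alpha> \<gamma>" for \<gamma>
    using helix_iff_bertrand_curve_helix[OF assms(1-3)] that
    by (simp add: bertrand_direction_curve_def)
  with assms(5) show ?thesis
    by (auto simp: bertrand_donor_curve_def)
qed

end
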